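(* If $L$ is a Tr-lattice, then each element of $L$ has at most two covers in $L$.
   Context: All matroids and lattices are finite. A flat $X$ of a matroid $M$ is cyclic if $M|X$ has no isthmuses; the cyclic flats ordered by inclusion form a lattice $\mathcal{Z}(M)$. A lattice $L$ is a Tr-lattice if every matroid $M$ with $\mathcal{Z}(M)$ isomorphic to $L$ is transversal. An element $y$ covers $x$ if $x<y$ and there is no $z$ with $x<z<y$. *)

theory Defs
  imports "HOL-Algebra.Lattice"
begin

text \<open>A matroid is given by its finite ground set \<open>E\<close> and its family \<open>\<I>\<close> of independent sets.\<close>

locale matroid =
  fixes E :: "'a set" and \<I> :: "'a set set"
  assumes finite_ground: "finite E"
    and indep_subset_ground: "X \<in> \<I> \<Longrightarrow> X \<subseteq> E"
    and indep_empty: "{} \<in> \<I>"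
    and indep_subset: "X \<in> \<I> \<Longrightarrow> Y \<subseteq> X \<Longrightarrow> Y \<in> \<I>"
    and indep_augment:
      "X \<in> \<I> \<Longrightarrow> Y \<in> \<I> \<Longrightarrow> card X < card Y \<Longrightarrow> \<exists>y \<in> Y - X. insert y X \<in> \<I>"

definition matroid_rank :: "'a set set \<Rightarrow> 'a set \<Rightarrow> nat" where
  "matroid_rank \<I> X = Max (card ` {Y \<in> \<I>. Y \<subseteq> X})"

definition flat :: "'a set \<Rightarrow> 'a set set \<Rightarrow> 'a set \<Rightarrow> bool" where
  "flat E \<I> X \<longleftrightarrow>
     X \<subseteq> E \<and> (\<forall>e \<in> E - X. matroid_rank \<I> X < matroid_rank \<I> (insert e X))"

definition basis :: "'a set set \<Rightarrow> 'a set \<Rightarrow> bool" where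
  "basis \<I> B \<longleftrightarrow> B \<in> \<I> \<and> (\<forall>Y \<in> \<I>. B \<subseteq> Y \<longrightarrow> Y = B)"

definition isthmus :: "'a set \<Rightarrow> 'a set set \<Rightarrow> 'a \<Rightarrow> bool" where
  "isthmus E \<I> e \<longleftrightarrow> e \<in> E \<and> (\<forall>B. basis \<I> B \<longrightarrow> e \<in> B)"

text \<open>The restriction \<open>M|X\<close> has ground set \<open>X\<close> and the following independent sets.\<close>

definition restrict_indep :: "'a set set \<Rightarrow> 'a set \<Rightarrow> 'a set set" where
  "restrict_indep \<I> X = {Y \<in> \<I>. Y \<subseteq> X}"

definition cyclic_flat :: "'a set \<Rightarrow> 'a set set \<Rightarrow> 'a set \<Rightarrow> bool" where
  "cyclic_flat E \<I> X \<longleftrightarrow> flat E \<I> X \<and> (\<nexists>e. isthmus X (restrict_indep \<I> X) e)"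

definition cyclic_flats :: "'a set \<Rightarrow> 'a set set \<Rightarrow> 'a set gorder" where
  "cyclic_flats E \<I> = \<lparr>carrier = {X. cyclic_flat E \<I> X}, eq = (=), le = (\<subseteq>)\<rparr>"

definition partial_transversal :: "nat \<Rightarrow> (nat \<Rightarrow> 'a set) \<Rightarrow> 'a set \<Rightarrow> bool" where
  "partial_transversal n A X \<longleftrightarrow>
     (\<exists>\<phi>. inj_on \<phi> X \<and> (\<forall>x \<in> X. \<phi> x < n \<and> x \<in> A (\<phi> x)))"

definition transversal :: "'a set \<Rightarrow> 'a set set \<Rightarrow> bool" where
  "transversal E \<I> \<longleftrightarrow>
     (\<exists>n A. (\<forall>i<n. A i \<subseteq> E) \<and> \<I> = {X. partial_transversal n A X})"

text \<open>An order isomorphism between lattices is the same thing as a lattice isomorphism.\<close>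

definition order_isomorphic ::
    "('a, 'c) gorder_scheme \<Rightarrow> ('b, 'd) gorder_scheme \<Rightarrow> bool" where
  "order_isomorphic P Q \<longleftrightarrow>
     (\<exists>f. bij_betw f (carrier P) (carrier Q) \<and>
          (\<forall>x \<in> carrier P. \<forall>y \<in> carrier P. x \<sqsubseteq>\<^bsub>P\<^esub> y \<longleftrightarrow> f x \<sqsubseteq>\<^bsub>Q\<^esub> f y))"

text \<open>HOL cannot quantify over all types inside a definition. Since ground sets are finite,
  every matroid is isomorphic to one whose ground set consists of natural numbers.\<close>

definition Tr_lattice :: "('l, 'm) gorder_scheme \<Rightarrow> bool" where
  "Tr_lattice L \<longleftrightarrow>
     lattice L \<and> finite (carrier L) \<and>
     (\<forall>(E :: nat set) \<I>. matroid E \<I> \<longrightarrow> order_isomorphic (cyclic_flats E \<I>) L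
        \<longrightarrow> transversal E \<I>)"

definition covers :: "('l, 'm) gorder_scheme \<Rightarrow> 'l \<Rightarrow> 'l \<Rightarrow> bool" where
  "covers L y x \<longleftrightarrow>
     x \<in> carrier L \<and> y \<in> carrier L \<and> x \<sqsubset>\<^bsub>L\<^esub> y \<and>
     \<not> (\<exists>z \<in> carrier L. x \<sqsubset>\<^bsub>L\<^esub> z \<and> z \<sqsubset>\<^bsub>L\<^esub> y)"

end

theory Submission
  imports Defs "HOL-Library.Nat_Bijection"
begin

text \<open>
  Let \<open>x\<close> have three covers. Choose an integer rank \<open>\<rho>\<close> on \<open>L\<close> that is strictly increasing and
  strictly submodular on incomparable pairs, and realise \<open>L\<close> as the cyclic flats
  \<open>Z y = (\<Union>w \<sqsubseteq> y. S w) \<union> (if x \<sqsubset> y then K else {})\<close> of rank \<open>\<rho> y\<close>, with large pairwise disjoint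
  sets \<open>S w\<close> and an extra set \<open>K\<close>. This is a matroid as long as \<open>|K|\<close> is at most the slack
  \<open>\<rho> y + \<rho> z - \<rho> x - \<rho> (y \<squnion> z)\<close> whenever \<open>y \<sqinter> z = x\<close> and \<open>x \<sqsubset> y, z\<close>; the least slack is attained
  by two covers \<open>a\<close>, \<open>b\<close> of \<open>x\<close>, and \<open>|K|\<close> is chosen equal to it.

  If the matroid had a presentation \<open>(A i)\<close>, then exactly \<open>\<rho> y\<close> of the sets \<open>A i\<close> would meet \<open>Z y\<close>.
  For a third cover \<open>c\<close>, inclusion-exclusion then bounds the rank \<open>\<rho> x + |K|\<close> of
  \<open>Z a \<inter> Z b \<inter> Z c\<close> by the alternating sum of \<open>\<rho>\<close> over the joins of \<open>a\<close>, \<open>b\<close>, \<open>c\<close>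
  (a Mason-Ingleton inequality), and strict submodularity makes that sum smaller
  than \<open>\<rho> x + |K|\<close>.
\<close>

lemma (in partial_order) lless_iff: "x \<sqsubset> y \<longleftrightarrow> x \<sqsubseteq> y \<and> x \<noteq> y"
  by (simp add: lless_def eq_is_equal)

lemma card_split: "finite X \<Longrightarrow> card X = card (X \<inter> A) + card (X - A)"
  by (metis card_Diff_subset_Int card_mono finite_Int inf_le1 le_add_diff_inverse)

section \<open>A matroid built from a ranked lattice of sets\<close>

text \<open>The sets \<open>core y\<close> play the role of Bonin and de Mier's size axiom
  \<open>\<rho> w - \<rho> y < |Z w - Z y|\<close>: any \<open>\<rho> y\<close> elements of \<open>core y\<close> form a basis of \<open>Z y\<close>. The factor 2 lets
  such a basis avoid any prescribed set of \<open>\<rho> y\<close> elements.\<close>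

locale cored_lattice = lattice L for L :: "('l, 'm) gorder_scheme" (structure) +
  fixes E :: "'e set" and Z core :: "'l \<Rightarrow> 'e set" and \<rho> :: "'l \<Rightarrow> nat" and bot :: 'l
  assumes finite_L: "finite (carrier L)"
    and finite_E: "finite E"
    and bot: "bot \<in> carrier L" "\<And>y. y \<in> carrier L \<Longrightarrow> bot \<sqsubseteq> y" "\<rho> bot = 0"
    and Z_subset: "y \<in> carrier L \<Longrightarrow> Z y \<subseteq> E"
    and Z_mono: "y \<in> carrier L \<Longrightarrow> w \<in> carrier L \<Longrightarrow> y \<sqsubseteq> w \<Longrightarrow> Z y \<subseteq> Z w"
    and core_subset: "y \<in> carrier L \<Longrightarrow> core y \<subseteq> Z y"
    and core_disjoint: "y \<in> carrier L \<Longrightarrow> w \<in> carrier L \<Longrightarrow> \<not> y \<sqsubseteq> w \<Longrightarrow> core y \<inter> Z w = {}"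
    and core_large: "y \<in> carrier L \<Longrightarrow> 2 * \<rho> y < card (core y)"
    and rho_strict: "y \<in> carrier L \<Longrightarrow> w \<in> carrier L \<Longrightarrow> y \<sqsubset> w \<Longrightarrow> \<rho> y < \<rho> w"
    and rho_submod: "y \<in> carrier L \<Longrightarrow> w \<in> carrier L \<Longrightarrow>
      \<rho> (y \<squnion> w) + \<rho> (y \<sqinter> w) + card (Z y \<inter> Z w - Z (y \<sqinter> w)) \<le> \<rho> y + \<rho> w"
begin

text \<open>The standard description of a matroid's independent sets by its cyclic flats and their
  ranks, taken here as the definition.\<close>

definition indep :: "'e set set" where
  "indep = {X. X \<subseteq> E \<and> (\<forall>y \<in> carrier L. card (X \<inter> Z y) \<le> \<rho> y)}"

lemma rho_mono: "y \<in> carrier L \<Longrightarrow> w \<in> carrier L \<Longrightarrow> y \<sqsubseteq> w \<Longrightarrow> \<rho> y \<le> \<rho> w"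
  using rho_strict[of y w] by (cases "y = w") (auto simp: lless_iff)

lemma indepD: "X \<in> indep \<Longrightarrow> y \<in> carrier L \<Longrightarrow> card (X \<inter> Z y) \<le> \<rho> y"
  by (simp add: indep_def)

lemma finite_subset_E: "X \<subseteq> E \<Longrightarrow> finite X"
  using finite_E finite_subset by blast

lemma indep_finite: "X \<in> indep \<Longrightarrow> finite X"
  by (simp add: indep_def finite_subset_E)

lemma indep_mono: "X \<in> indep \<Longrightarrow> Y \<subseteq> X \<Longrightarrow> Y \<in> indep"
proof -
  assume X: "X \<in> indep" and YX: "Y \<subseteq> X"
  have "card (Y \<inter> Z y) \<le> \<rho> y" if "y \<in> carrier L" for y
  proof -
    have "card (Y \<inter> Z y) \<le> card (X \<inter> Z y)"
      using YX indep_finite[OF X] by (intro card_mono) auto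
    with indepD[OF X that] show ?thesis by simp
  qed
  then show "Y \<in> indep" using X YX by (auto simp: indep_def)
qed

text \<open>Count \<open>X \<inter> Z y\<close> and \<open>X \<inter> Z w\<close> by union and
  intersection. Elements of \<open>X\<close> in both sets but outside
  \<open>Z (y \<sqinter> w)\<close> are paid for by the extra term in \<open>rho_submod\<close>, so
  every inequality in the count is an equality.\<close>

lemma tight_join:
  assumes X: "X \<in> indep" and y: "y \<in> carrier L" and w: "w \<in> carrier L"
    and ty: "card (X \<inter> Z y) = \<rho> y" and tw: "card (X \<inter> Z w) = \<rho> w"
  shows "card (X \<inter> Z (y \<squnion> w)) = \<rho> (y \<squnion> w)"
proof -
  note fin = indep_finite[OF X]
  have jc: "y \<squnion> w \<in> carrier L" and mc: "y \<sqinter> w \<in> carrier L" using y w by auto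
  have "\<rho> y + \<rho> w = card ((X \<inter> Z y) \<union> (X \<inter> Z w)) + card ((X \<inter> Z y) \<inter> (X \<inter> Z w))"
    using fin ty tw by (metis card_Un_Int finite_Int)
  moreover have "card ((X \<inter> Z y) \<union> (X \<inter> Z w)) \<le> card (X \<inter> Z (y \<squnion> w))"
    using Z_mono[OF y jc join_left[OF y w]] Z_mono[OF w jc join_right[OF y w]] fin
    by (intro card_mono) auto
  moreover have "card ((X \<inter> Z y) \<inter> (X \<inter> Z w))
      \<le> card ((X \<inter> Z (y \<sqinter> w)) \<union> (Z y \<inter> Z w - Z (y \<sqinter> w)))"
    using fin finite_subset_E[OF Z_subset[OF y]] by (intro card_mono) auto
  moreover have "\<dots> \<le> card (X \<inter> Z (y \<sqinter> w)) + card (Z y \<inter> Z w - Z (y \<sqinter> w))"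
    by (rule card_Un_le)
  ultimately show ?thesis
    using rho_submod[OF y w] indepD[OF X jc] indepD[OF X mc] by linarith
qed

text \<open>Tight elements are closed under joins, so one of greatest rank lies above all others. If
  adding \<open>f\<close> destroys independence, the bound fails at some \<open>y\<close> that was
  already tight and has \<open>f \<in> Z y\<close>; since \<open>y\<close> lies below
  \<open>t\<close>, also \<open>f \<in> Z t\<close>.\<close>

lemma ex_max_tight:
  assumes X: "X \<in> indep"
  obtains t where "t \<in> carrier L" "card (X \<inter> Z t) = \<rho> t"
    "\<And>f. f \<in> E \<Longrightarrow> insert f X \<notin> indep \<Longrightarrow> f \<in> Z t"
proof -
  let ?P = "\<lambda>t. t \<in> carrier L \<and> card (X \<inter> Z t) = \<rho> t"
  have "?P bot" using bot indepD[OF X bot(1)] by simp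
  moreover have "\<forall>y. ?P y \<longrightarrow> \<rho> y < Suc (card X)"
    using indep_finite[OF X] by (metis card_mono inf_le1 le_imp_less_Suc)
  ultimately obtain t where t: "?P t" and tmax: "\<And>y. ?P y \<Longrightarrow> \<rho> y \<le> \<rho> t"
    using ex_has_greatest_nat[of ?P bot \<rho>] by blast
  have below: "w \<sqsubseteq> t" if "?P w" for w
  proof -
    have jc: "t \<squnion> w \<in> carrier L" using t that by auto
    have "\<rho> (t \<squnion> w) \<le> \<rho> t"
      using tight_join[OF X] t that jc by (intro tmax) auto
    moreover have "t \<sqsubseteq> t \<squnion> w" using t that join_left by auto
    ultimately have "t = t \<squnion> w"
      using rho_strict[of t "t \<squnion> w"] t jc by (auto simp: lless_iff)
    then show ?thesis using t that join_right[of t w] by auto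
  qed
  show thesis
  proof (rule that[of t])
    fix f assume f: "f \<in> E" "insert f X \<notin> indep"
    then obtain y where y: "y \<in> carrier L" "\<rho> y < card (insert f X \<inter> Z y)"
      using X by (auto simp: indep_def not_le)
    have fy: "f \<in> Z y" using y indepD[OF X y(1)] by (cases "f \<in> Z y") auto
    have "card (insert f X \<inter> Z y) \<le> Suc (card (X \<inter> Z y))"
      using fy by (simp add: card_insert_le_m1 card_insert_if indep_finite[OF X])
    then have "?P y" using y indepD[OF X y(1)] by auto
    then show "f \<in> Z t" using below Z_mono t fy by blast
  qed (use t in auto)
qed

text \<open>If nothing in \<open>Y - X\<close> augments \<open>X\<close>, then \<open>Y - X\<close>
  lies in \<open>Z t\<close> for the largest tight \<open>t\<close>. Outside \<open>Z t\<close> the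
  set \<open>Y\<close> is then contained in \<open>X\<close>, and inside it \<open>X\<close> already
  has the maximal size \<open>\<rho> t\<close>, so \<open>card Y \<le> card X\<close>.\<close>

lemma matroid_indep: "matroid E indep"
proof
  fix X Y assume X: "X \<in> indep" and Y: "Y \<in> indep" and lt: "card X < card Y"
  show "\<exists>y \<in> Y - X. insert y X \<in> indep"
  proof (rule ccontr)
    assume neg: "\<not> ?thesis"
    obtain t where t: "t \<in> carrier L" "card (X \<inter> Z t) = \<rho> t"
      "\<And>f. f \<in> E \<Longrightarrow> insert f X \<notin> indep \<Longrightarrow> f \<in> Z t" by (rule ex_max_tight[OF X]) blast
    have "Y - X \<subseteq> Z t" using neg t(3) Y by (auto simp: indep_def)
    then have "card (Y - Z t) \<le> card (X - Z t)"
      using indep_finite[OF X] by (intro card_mono) auto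
    then show False
      using lt card_split[OF indep_finite[OF X], of "Z t"] t(2) indepD[OF Y t(1)]
        card_split[OF indep_finite[OF Y], of "Z t"] by linarith
  qed
next
  show "{} \<in> indep" by (simp add: indep_def)
  show "X \<subseteq> E" if "X \<in> indep" for X using that by (simp add: indep_def)
qed (use finite_E indep_mono in auto)

lemma core_basis_indep:
  assumes y: "y \<in> carrier L" and B: "B \<subseteq> core y" and c: "card B \<le> \<rho> y"
  shows "B \<in> indep"
proof -
  have "card (B \<inter> Z w) \<le> \<rho> w" if w: "w \<in> carrier L" for w
  proof (cases "y \<sqsubseteq> w")
    case True
    have BE: "B \<subseteq> E" using B core_subset[OF y] Z_subset[OF y] by auto
    have "card (B \<inter> Z w) \<le> card B"
      using finite_subset_E[OF BE] by (intro card_mono) auto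
    then show ?thesis using c rho_mono[OF y w True] by linarith
  next
    case False
    then have "B \<inter> Z w = {}" using core_disjoint[OF y w] B by blast
    then show ?thesis by simp
  qed
  then show ?thesis using B core_subset[OF y] Z_subset[OF y] by (auto simp: indep_def)
qed

text \<open>The \<open>+ 1\<close> lets \<open>F\<close> be a singleton even when
  \<open>\<rho> y = 0\<close>; this is needed to avoid a would-be isthmus.\<close>

lemma ex_core_basis:
  assumes y: "y \<in> carrier L" and F: "finite F" "card F \<le> \<rho> y + 1"
  obtains B where "B \<subseteq> core y - F" "card B = \<rho> y" "B \<in> indep" "finite B"
proof -
  have "\<rho> y \<le> card (core y) - card F" using core_large[OF y] F by linarith
  also have "\<dots> \<le> card (core y - F)" using F by (intro diff_card_le_card_Diff)
  finally obtain B where "B \<subseteq> core y - F" "card B = \<rho> y" "finite B"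
    by (rule obtain_subset_with_card_n)
  then show thesis using core_basis_indep[OF y, of B] by (intro that[of B]) auto
qed

section \<open>Ranks and cyclic flats of this matroid\<close>

lemma card_indep_le: "X \<in> indep \<Longrightarrow> y \<in> carrier L \<Longrightarrow> X \<subseteq> Z y \<Longrightarrow> card X \<le> \<rho> y"
  using indepD[of X y] by (simp add: inf_absorb1)

lemma finite_indep_within: "finite {Y \<in> indep. Y \<subseteq> X}"
  by (rule finite_subset[of _ "Pow E"]) (auto simp: indep_def finite_E)

lemma rank_ge: "Y \<in> indep \<Longrightarrow> Y \<subseteq> X \<Longrightarrow> card Y \<le> matroid_rank indep X"
  unfolding matroid_rank_def using finite_indep_within by (intro Max_ge) auto

lemma rank_attained:
  obtains B where "B \<in> indep" "B \<subseteq> X" "card B = matroid_rank indep X"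
proof -
  have "matroid_rank indep X \<in> card ` {Y \<in> indep. Y \<subseteq> X}"
    unfolding matroid_rank_def using finite_indep_within matroid.indep_empty[OF matroid_indep]
    by (intro Max_in) auto
  then show thesis using that by auto
qed

lemma rank_Z:
  assumes y: "y \<in> carrier L"
  shows "matroid_rank indep (Z y) = \<rho> y"
proof (rule antisym)
  show "matroid_rank indep (Z y) \<le> \<rho> y"
    using rank_attained[of "Z y"] card_indep_le[OF _ y] by metis
  obtain B where "B \<subseteq> core y - {}" "card B = \<rho> y" "B \<in> indep"
    by (rule ex_core_basis[OF y, of "{}"]) auto
  then show "\<rho> y \<le> matroid_rank indep (Z y)"
    using rank_ge[of B "Z y"] core_subset[OF y] by auto
qed

text \<open>A basis inside \<open>core y\<close> stays independent when an element outside
  \<open>Z y\<close> is added, which gives flatness. It can also be chosen to avoid any prescribed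
  element, so there is no isthmus.\<close>

lemma cyclic_flat_Z:
  assumes y: "y \<in> carrier L"
  shows "cyclic_flat E indep (Z y)"
  unfolding cyclic_flat_def flat_def
proof (intro conjI ballI notI)
  show "Z y \<subseteq> E" by (rule Z_subset[OF y])
next
  fix e assume e: "e \<in> E - Z y"
  obtain B where B: "B \<subseteq> core y - {}" "card B = \<rho> y" "B \<in> indep" "finite B"
    by (rule ex_core_basis[OF y, of "{}"]) auto
  have BZ: "B \<subseteq> Z y" using B core_subset[OF y] by auto
  have "card (insert e B \<inter> Z w) \<le> \<rho> w" if w: "w \<in> carrier L" for w
  proof (cases "e \<in> Z w")
    case False
    then show ?thesis using indepD[OF B(3) w] by simp
  next
    case True
    show ?thesis
    proof (cases "y \<sqsubseteq> w")
      case yw: True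
      have "\<rho> y < \<rho> w" using True e rho_strict[OF y w] yw by (auto simp: lless_iff)
      moreover have "card (insert e B \<inter> Z w) \<le> card (insert e B)"
        using B by (intro card_mono) auto
      moreover have "\<dots> = Suc (\<rho> y)" using B e BZ by (subst card_insert_disjoint) auto
      ultimately show ?thesis by linarith
    next
      case False
      then have "B \<inter> Z w = {}" using core_disjoint[OF y w] B by blast
      then have "insert e B \<inter> Z w = {e}" using True by auto
      \<comment> \<open>Only \<open>e\<close> is counted here, so it suffices that
        \<open>\<rho> w\<close> is positive; \<open>bot\<close> is excluded because
        \<open>Z bot \<subseteq> Z y\<close> misses \<open>e\<close>.\<close>
      moreover have "w \<noteq> bot" using True e Z_mono[OF bot(1) y bot(2)[OF y]] by auto
      then have "0 < \<rho> w" using rho_strict[OF bot(1) w] bot w by (auto simp: lless_iff)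
      ultimately show ?thesis by simp
    qed
  qed
  then have "insert e B \<in> indep" using B e by (auto simp: indep_def)
  then have "card (insert e B) \<le> matroid_rank indep (insert e (Z y))"
    using BZ by (intro rank_ge) auto
  moreover have "card (insert e B) = Suc (\<rho> y)"
    using B e BZ by (subst card_insert_disjoint) auto
  ultimately show "matroid_rank indep (Z y) < matroid_rank indep (insert e (Z y))"
    using rank_Z[OF y] by simp
next
  assume "\<exists>e. isthmus (Z y) (restrict_indep indep (Z y)) e"
  then obtain e where e: "isthmus (Z y) (restrict_indep indep (Z y)) e" ..
  obtain B where B: "B \<subseteq> core y - {e}" "card B = \<rho> y" "B \<in> indep" "finite B"
    by (rule ex_core_basis[OF y, of "{e}"]) auto
  have "basis (restrict_indep indep (Z y)) B"
    unfolding basis_def restrict_indep_def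
  proof (intro conjI ballI impI)
    show "B \<in> {Y \<in> indep. Y \<subseteq> Z y}" using B core_subset[OF y] by auto
    fix Y assume "Y \<in> {Y \<in> indep. Y \<subseteq> Z y}" "B \<subseteq> Y"
    then show "Y = B"
      using card_indep_le[OF _ y, of Y] B(2) card_seteq[of Y B] indep_finite by force
  qed
  then show False using e B by (auto simp: isthmus_def)
qed

lemma basis_restrict_card:
  assumes "X \<subseteq> E" and B: "basis (restrict_indep indep X) B"
  shows "card B = matroid_rank indep X"
proof (rule antisym)
  have Bi: "B \<in> indep" "B \<subseteq> X" using B by (auto simp: basis_def restrict_indep_def)
  then show "card B \<le> matroid_rank indep X" by (rule rank_ge)
  obtain C where C: "C \<in> indep" "C \<subseteq> X" "card C = matroid_rank indep X"
    by (rule rank_attained)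
  show "matroid_rank indep X \<le> card B"
  proof (rule ccontr)
    assume "\<not> ?thesis"
    then obtain e where "e \<in> C - B" "insert e B \<in> indep"
      using matroid.indep_augment[OF matroid_indep Bi(1) C(1)] C(3) by auto
    then show False using B C Bi by (auto simp: basis_def restrict_indep_def)
  qed
qed

text \<open>Let \<open>t\<close> be the largest tight element for a basis \<open>B\<close> of
  \<open>X\<close>. Then \<open>B\<close> and \<open>X\<close> agree outside \<open>Z t\<close>, so
  \<open>X\<close> has rank \<open>\<rho> t + card (X - Z t)\<close>. A basis of \<open>X\<close>
  omitting some \<open>f \<in> X - Z t\<close> would be too small, hence
  \<open>X \<subseteq> Z t\<close>; now \<open>X\<close> and \<open>Z t\<close> have equal rank and
  flatness gives equality.\<close>

lemma cyclic_flat_is_Z: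
  assumes X: "cyclic_flat E indep X"
  shows "\<exists>t \<in> carrier L. X = Z t"
proof -
  have XE: "X \<subseteq> E" and flat: "\<And>e. e \<in> E - X \<Longrightarrow> matroid_rank indep X < matroid_rank indep (insert e X)"
    and cyc: "\<And>e. \<not> isthmus X (restrict_indep indep X) e"
    using X by (auto simp: cyclic_flat_def flat_def)
  obtain B where B: "B \<in> indep" "B \<subseteq> X" "card B = matroid_rank indep X"
    by (rule rank_attained)
  obtain t where t: "t \<in> carrier L" "card (B \<inter> Z t) = \<rho> t"
    "\<And>f. f \<in> E \<Longrightarrow> insert f B \<notin> indep \<Longrightarrow> f \<in> Z t" by (rule ex_max_tight[OF B(1)]) blast
  have out: "f \<in> Z t" if f: "f \<in> X - B" for f
  proof (rule t(3))
    show "f \<in> E" using f XE by auto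
    show "insert f B \<notin> indep"
    proof
      assume "insert f B \<in> indep"
      then have "card (insert f B) \<le> card B"
        using rank_ge[of "insert f B" X] B f by auto
      then show False using f indep_finite[OF B(1)] by auto
    qed
  qed
  then have eq: "B - Z t = X - Z t" using B by auto
  have rankX: "matroid_rank indep X = \<rho> t + card (X - Z t)"
    using card_split[OF indep_finite[OF B(1)], of "Z t"] B(3) t(2) eq by simp
  have sub: "X \<subseteq> Z t"
  proof
    fix f assume fX: "f \<in> X"
    show "f \<in> Z t"
    proof (rule ccontr)
      assume ft: "f \<notin> Z t"
      obtain C where C: "basis (restrict_indep indep X) C" "f \<notin> C"
        using cyc[of f] fX by (auto simp: isthmus_def)
      have Ci: "C \<in> indep" "C \<subseteq> X" using C by (auto simp: basis_def restrict_indep_def)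
      have "C - Z t \<subset> X - Z t" using Ci C(2) fX ft by auto
      then have "card (C - Z t) < card (X - Z t)"
        using finite_subset_E[OF XE] by (intro psubset_card_mono) auto
      then show False
        using card_split[OF indep_finite[OF Ci(1)], of "Z t"] indepD[OF Ci(1) t(1)]
          basis_restrict_card[OF XE C(1)] rankX by linarith
    qed
  qed
  have "Z t \<subseteq> X"
  proof
    fix e assume e: "e \<in> Z t"
    show "e \<in> X"
    proof (rule ccontr)
      assume "e \<notin> X"
      then have "matroid_rank indep X < matroid_rank indep (insert e X)"
        using e Z_subset[OF t(1)] by (intro flat) auto
      moreover obtain C where "C \<in> indep" "C \<subseteq> insert e X" "card C = matroid_rank indep (insert e X)"
        by (rule rank_attained)
      then have "matroid_rank indep (insert e X) \<le> \<rho> t"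
        using card_indep_le[OF _ t(1), of C] e sub by auto
      ultimately show False using rankX by linarith
    qed
  qed
  with sub t(1) show ?thesis by auto
qed

lemma Z_subset_iff:
  assumes y: "y \<in> carrier L" and w: "w \<in> carrier L"
  shows "Z y \<subseteq> Z w \<longleftrightarrow> y \<sqsubseteq> w"
proof
  assume "Z y \<subseteq> Z w"
  \<comment> \<open>The strict inequality in \<open>core_large\<close> makes the core nonempty even
    at rank 0.\<close>
  moreover have "core y \<noteq> {}" using core_large[OF y] by auto
  ultimately show "y \<sqsubseteq> w" using core_disjoint[OF y w] core_subset[OF y] by blast
qed (rule Z_mono[OF y w])

lemma cyclic_flats_isomorphic: "order_isomorphic (cyclic_flats E indep) L"
proof -
  have inj: "inj_on Z (carrier L)"
    by (rule inj_onI) (metis Z_subset_iff order_refl le_antisym)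
  have img: "Z ` carrier L = {X. cyclic_flat E indep X}"
    using cyclic_flat_Z cyclic_flat_is_Z by blast
  let ?f = "inv_into (carrier L) Z"
  have "bij_betw ?f {X. cyclic_flat E indep X} (carrier L)"
    using inj img by (metis bij_betw_imageI bij_betw_inv_into)
  moreover have "X \<subseteq> Y \<longleftrightarrow> ?f X \<sqsubseteq> ?f Y"
    if XY: "cyclic_flat E indep X" "cyclic_flat E indep Y" for X Y
  proof -
    obtain y w where "y \<in> carrier L" "X = Z y" "w \<in> carrier L" "Y = Z w"
      using cyclic_flat_is_Z[OF XY(1)] cyclic_flat_is_Z[OF XY(2)] by blast
    then show ?thesis using Z_subset_iff inj by (simp add: inv_into_f_f)
  qed
  ultimately show ?thesis
    unfolding order_isomorphic_def cyclic_flats_def by (intro exI[of _ ?f]) auto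
qed

end

section \<open>Presentations of transversal matroids and a Mason-Ingleton inequality\<close>

lemma card_Un3_Int3:
  assumes "finite A" "finite B" "finite C"
  shows "card (A \<inter> B \<inter> C) + card (A \<union> B) + card (A \<union> C) + card (B \<union> C)
    = card A + card B + card C + card (A \<union> B \<union> C)"
proof -
  have "card (A \<union> B) + card C = card (A \<union> B \<union> C) + card ((A \<inter> C) \<union> (B \<inter> C))"
    using assms card_Un_Int[of "A \<union> B" C] by (simp add: Int_Un_distrib2)
  moreover have "card (A \<inter> C) + card (B \<inter> C) = card ((A \<inter> C) \<union> (B \<inter> C)) + card (A \<inter> B \<inter> C)"
    using assms card_Un_Int[of "A \<inter> C" "B \<inter> C"] by (simp add: ac_simps)
  ultimately show ?thesis
    using card_Un_Int[OF assms(1,3)] card_Un_Int[OF assms(2,3)] by linarith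
qed

lemma partial_transversal_card_le:
  assumes "partial_transversal n A X"
  shows "card X \<le> card {i. i < n \<and> A i \<inter> X \<noteq> {}}"
proof -
  obtain \<phi> where "inj_on \<phi> X" "\<forall>x \<in> X. \<phi> x < n \<and> x \<in> A (\<phi> x)"
    using assms by (auto simp: partial_transversal_def)
  then show ?thesis by (intro card_inj_on_le[of \<phi>]) auto
qed

lemma partial_transversal_insert:
  assumes "inj_on \<phi> X" "\<forall>x \<in> X. \<phi> x < n \<and> x \<in> A (\<phi> x)"
    and "i < n" "i \<notin> \<phi> ` X" "f \<in> A i" "f \<notin> X"
  shows "partial_transversal n A (insert f X)"
  unfolding partial_transversal_def
proof (intro exI conjI)
  show "inj_on (\<phi>(f := i)) (insert f X)"
    using assms by (auto simp: inj_on_def)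
qed (use assms in auto)

context cored_lattice
begin

text \<open>If \<open>A i\<close> met \<open>Z y\<close> in at most \<open>\<rho> y\<close> elements, a basis of \<open>Z y\<close> inside \<open>core y - A i\<close> could be
  enlarged by matching some element of \<open>Z y\<close> to \<open>i\<close>. So \<open>A i \<inter> Z y\<close> is never contained in a basis \<open>B\<close>,
  and the same enlargement shows that every matching of \<open>B\<close> uses \<open>i\<close>.\<close>

lemma card_presentation_of_Z:
  assumes tr: "indep = {X. partial_transversal n A X}" and y: "y \<in> carrier L"
  shows "card {i. i < n \<and> A i \<inter> Z y \<noteq> {}} = \<rho> y" (is "card ?N = _")
proof (rule antisym)
  obtain B where B: "B \<subseteq> core y - {}" "card B = \<rho> y" "B \<in> indep" "finite B"
    by (rule ex_core_basis[OF y, of "{}"]) auto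
  have used: "i \<in> \<phi> ` C" if C: "C \<subseteq> Z y" "card C = \<rho> y" "finite C" and i: "i < n"
    and \<phi>: "inj_on \<phi> C" "\<forall>x \<in> C. \<phi> x < n \<and> x \<in> A (\<phi> x)" and f: "f \<in> A i \<inter> Z y" "f \<notin> C"
    for i C f \<phi>
  proof (rule ccontr)
    assume "i \<notin> \<phi> ` C"
    then have "insert f C \<in> indep"
      using partial_transversal_insert[OF \<phi> i] f tr by auto
    then have "card (insert f C) \<le> \<rho> y" using C f by (intro card_indep_le[OF _ y]) auto
    then show False using C f by auto
  qed
  have large: "\<not> A i \<inter> Z y \<subseteq> B" if i: "i \<in> ?N" for i
  proof
    assume AB: "A i \<inter> Z y \<subseteq> B"
    then have "card (A i \<inter> Z y) \<le> \<rho> y" using B card_mono by metis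
    moreover have "finite (A i \<inter> Z y)" using AB B(4) by (rule finite_subset)
    ultimately obtain C where
      C: "C \<subseteq> core y - A i \<inter> Z y" "card C = \<rho> y" "C \<in> indep" "finite C"
      by (auto intro: ex_core_basis[OF y, of "A i \<inter> Z y"])
    obtain f where f: "f \<in> A i \<inter> Z y" using i by auto
    obtain \<phi> where \<phi>: "inj_on \<phi> C" "\<forall>x \<in> C. \<phi> x < n \<and> x \<in> A (\<phi> x)"
      using C tr by (auto simp: partial_transversal_def)
    have "i \<in> \<phi> ` C" using used[OF _ C(2,4) _ \<phi> f] C i f core_subset[OF y] by blast
    then show False using \<phi> C core_subset[OF y] by blast
  qed
  obtain \<phi> where \<phi>: "inj_on \<phi> B" "\<forall>x \<in> B. \<phi> x < n \<and> x \<in> A (\<phi> x)"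
    using B tr by (auto simp: partial_transversal_def)
  have "?N \<subseteq> \<phi> ` B"
  proof
    fix i assume i: "i \<in> ?N"
    then obtain f where "f \<in> A i \<inter> Z y" "f \<notin> B" using large by blast
    then show "i \<in> \<phi> ` B" using used[OF _ B(2,4) _ \<phi>] i B core_subset[OF y] by blast
  qed
  then show "card ?N \<le> \<rho> y"
    using card_mono[of "\<phi> ` B" ?N] card_image_le[OF B(4), of \<phi>] B by simp
  have "card B \<le> card {i. i < n \<and> A i \<inter> B \<noteq> {}}"
    using B tr by (intro partial_transversal_card_le) auto
  also have "\<dots> \<le> card ?N" using B core_subset[OF y] by (intro card_mono) auto
  finally show "\<rho> y \<le> card ?N" using B by simp
qed

text \<open>Take \<open>\<rho> a\<close> elements of \<open>core a\<close> and
  \<open>\<rho> (a \<squnion> b) - \<rho> a\<close> of \<open>core b\<close>. Any \<open>Z w\<close>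
  meeting both parts has \<open>w\<close> above \<open>a \<squnion> b\<close>, so the union is
  independent; a matching of it uses only sets that meet \<open>Z a\<close> or
  \<open>Z b\<close>.\<close>

lemma card_presentation_of_Z_Un:
  assumes tr: "indep = {X. partial_transversal n A X}"
    and a: "a \<in> carrier L" and b: "b \<in> carrier L" and ab: "\<not> a \<sqsubseteq> b" "\<not> b \<sqsubseteq> a"
  shows "\<rho> (a \<squnion> b) \<le> card ({i. i < n \<and> A i \<inter> Z a \<noteq> {}} \<union> {i. i < n \<and> A i \<inter> Z b \<noteq> {}})"
proof -
  have jc: "a \<squnion> b \<in> carrier L" using a b by auto
  have le: "\<rho> (a \<squnion> b) \<le> \<rho> a + \<rho> b" using rho_submod[OF a b] by linarith
  obtain B where B: "B \<subseteq> core a - {}" "card B = \<rho> a" "B \<in> indep" "finite B"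
    by (rule ex_core_basis[OF a, of "{}"]) auto
  obtain C0 where C0: "C0 \<subseteq> core b - {}" "card C0 = \<rho> b" "C0 \<in> indep" "finite C0"
    by (rule ex_core_basis[OF b, of "{}"]) auto
  have "\<rho> (a \<squnion> b) - \<rho> a \<le> card C0" using le C0 by linarith
  then obtain C where C: "C \<subseteq> C0" "card C = \<rho> (a \<squnion> b) - \<rho> a" "finite C"
    by (rule obtain_subset_with_card_n)
  have Ci: "C \<in> indep" using indep_mono[OF C0(3) C(1)] .
  have BZ: "B \<subseteq> Z a" "C \<subseteq> Z b" using B C C0 core_subset a b by blast+
  have "B \<inter> C = {}" using BZ B core_disjoint[OF a b ab(1)] by blast
  then have card: "card (B \<union> C) = \<rho> (a \<squnion> b)"
    using B C card_Un_disjoint[of B C] rho_mono[OF a jc] join_left[OF a b] by simp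
  have "card ((B \<union> C) \<inter> Z w) \<le> \<rho> w" if w: "w \<in> carrier L" for w
  proof -
    consider "a \<sqsubseteq> w" "b \<sqsubseteq> w" | "\<not> a \<sqsubseteq> w" | "\<not> b \<sqsubseteq> w" by blast
    then show ?thesis
    proof cases
      case 1
      have "card ((B \<union> C) \<inter> Z w) \<le> card (B \<union> C)" using B C by (intro card_mono) auto
      then show ?thesis using card rho_mono[OF jc w join_le[OF 1 a b w]] by linarith
    next
      case 2
      then have "(B \<union> C) \<inter> Z w = C \<inter> Z w" using core_disjoint[OF a w] B by blast
      then show ?thesis using indepD[OF Ci w] by simp
    next
      case 3
      then have "(B \<union> C) \<inter> Z w = B \<inter> Z w" using core_disjoint[OF b w] C C0 by blast
      then show ?thesis using indepD[OF B(3) w] by simp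
    qed
  qed
  then have "B \<union> C \<in> indep" using B Ci by (auto simp: indep_def)
  then have "\<rho> (a \<squnion> b) \<le> card {i. i < n \<and> A i \<inter> (B \<union> C) \<noteq> {}}"
    using tr card partial_transversal_card_le[of n A "B \<union> C"] by auto
  also have "\<dots> \<le> card ({i. i < n \<and> A i \<inter> Z a \<noteq> {}} \<union> {i. i < n \<and> A i \<inter> Z b \<noteq> {}})"
    using BZ by (intro card_mono) auto
  finally show ?thesis .
qed

text \<open>A matching sends \<open>T\<close> into the indices whose sets meet all of
  \<open>Z a\<close>, \<open>Z b\<close> and \<open>Z c\<close>. Inclusion-exclusion, with exact
  counts for single sets, lower bounds for pairs and the upper bound \<open>\<rho> t\<close> for the
  triple union, contradicts the last hypothesis.\<close>

lemma not_transversal: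
  assumes abc: "a \<in> carrier L" "b \<in> carrier L" "c \<in> carrier L"
    and inc: "\<not> a \<sqsubseteq> b" "\<not> b \<sqsubseteq> a" "\<not> a \<sqsubseteq> c" "\<not> c \<sqsubseteq> a" "\<not> b \<sqsubseteq> c" "\<not> c \<sqsubseteq> b"
    and t: "t \<in> carrier L" "a \<sqsubseteq> t" "b \<sqsubseteq> t" "c \<sqsubseteq> t"
    and T: "T \<in> indep" "T \<subseteq> Z a" "T \<subseteq> Z b" "T \<subseteq> Z c"
    and lt: "\<rho> a + \<rho> b + \<rho> c + \<rho> t < card T + \<rho> (a \<squnion> b) + \<rho> (a \<squnion> c) + \<rho> (b \<squnion> c)"
  shows "\<not> transversal E indep"
proof
  assume "transversal E indep"
  then obtain n A where tr: "indep = {X. partial_transversal n A X}"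
    by (auto simp: transversal_def)
  define N where "N y = {i. i < n \<and> A i \<inter> Z y \<noteq> {}}" for y
  have fin: "finite (N y)" for y by (simp add: N_def)
  have rank: "card (N y) = \<rho> y" if "y \<in> carrier L" for y
    using card_presentation_of_Z[OF tr that] by (simp add: N_def)
  have pair: "\<rho> (y \<squnion> w) \<le> card (N y \<union> N w)"
    if "y \<in> carrier L" "w \<in> carrier L" "\<not> y \<sqsubseteq> w" "\<not> w \<sqsubseteq> y" for y w
    using card_presentation_of_Z_Un[OF tr that] by (simp add: N_def)
  have "card T \<le> card {i. i < n \<and> A i \<inter> T \<noteq> {}}"
    using T tr by (intro partial_transversal_card_le) auto
  also have "\<dots> \<le> card (N a \<inter> N b \<inter> N c)"
    using T by (intro card_mono) (auto simp: N_def)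
  finally have "card T \<le> card (N a \<inter> N b \<inter> N c)" .
  moreover have "N a \<union> N b \<union> N c \<subseteq> N t"
    using Z_mono[OF _ t(1)] abc t by (fastforce simp: N_def)
  then have "card (N a \<union> N b \<union> N c) \<le> \<rho> t"
    using card_mono[OF fin] rank[OF t(1)] by metis
  ultimately show False
    using card_Un3_Int3[OF fin[of a] fin[of b] fin[of c]] rank abc lt
      pair[of a b] pair[of a c] pair[of b c] inc by simp
qed

end

section \<open>Strictly submodular ranks and covers\<close>

locale strict_rank_lattice = lattice L for L :: "('l, 'm) gorder_scheme" (structure) +
  fixes \<rho> :: "'l \<Rightarrow> nat"
  assumes finite_L: "finite (carrier L)"
    and rho_strict: "y \<in> carrier L \<Longrightarrow> w \<in> carrier L \<Longrightarrow> y \<sqsubset> w \<Longrightarrow> \<rho> y < \<rho> w"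
    and rho_strict_submod: "y \<in> carrier L \<Longrightarrow> w \<in> carrier L \<Longrightarrow> \<not> y \<sqsubseteq> w \<Longrightarrow> \<not> w \<sqsubseteq> y \<Longrightarrow>
      \<rho> (y \<squnion> w) + \<rho> (y \<sqinter> w) < \<rho> y + \<rho> w"
    and rho_least: "z \<in> carrier L \<Longrightarrow> \<forall>y \<in> carrier L. z \<sqsubseteq> y \<Longrightarrow> \<rho> z = 0"
begin

lemma rho_mono: "y \<in> carrier L \<Longrightarrow> w \<in> carrier L \<Longrightarrow> y \<sqsubseteq> w \<Longrightarrow> \<rho> y \<le> \<rho> w"
  using rho_strict[of y w] by (cases "y = w") (auto simp: lless_iff)

lemma comparable_modular:
  assumes "y \<in> carrier L" "w \<in> carrier L" "y \<sqsubseteq> w \<or> w \<sqsubseteq> y"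
  shows "\<rho> (y \<squnion> w) + \<rho> (y \<sqinter> w) = \<rho> y + \<rho> w"
  using assms le_iff_join le_iff_meet join_comm[of L y w] meet_comm[of L y w] by (metis add.commute)

lemma rho_submod:
  "y \<in> carrier L \<Longrightarrow> w \<in> carrier L \<Longrightarrow> \<rho> (y \<squnion> w) + \<rho> (y \<sqinter> w) \<le> \<rho> y + \<rho> w"
  using rho_strict_submod[of y w] comparable_modular[of y w] by fastforce

text \<open>The slack \<open>\<rho> y + \<rho> z - \<rho> (y \<squnion> z)\<close> is monotone, so its minimum over pairs meeting in \<open>x\<close> is attained
  by covers of \<open>x\<close>.\<close>

lemma slack_mono:
  assumes c: "a \<in> carrier L" "b \<in> carrier L" "y \<in> carrier L" "z \<in> carrier L"
    and le: "a \<sqsubseteq> y" "b \<sqsubseteq> z"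
  shows "\<rho> a + \<rho> b + \<rho> (y \<squnion> z) \<le> \<rho> y + \<rho> z + \<rho> (a \<squnion> b)"
proof -
  let ?j = "a \<squnion> b"
  have j: "?j \<in> carrier L" "y \<squnion> ?j \<in> carrier L" "a \<sqsubseteq> ?j" "b \<sqsubseteq> ?j"
    using c join_left join_right by auto
  have yj: "y \<sqsubseteq> y \<squnion> ?j" "?j \<sqsubseteq> y \<squnion> ?j" using c j join_left join_right by auto
  have "b \<sqsubseteq> y \<squnion> ?j" using c j yj le_trans by blast
  then have "b \<sqsubseteq> z \<sqinter> (y \<squnion> ?j)" using c j le by (intro meet_le) auto
  then have 1: "\<rho> b \<le> \<rho> (z \<sqinter> (y \<squnion> ?j))" using c j by (intro rho_mono) auto
  have "a \<sqsubseteq> y \<sqinter> ?j" using c j le by (intro meet_le) auto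
  then have 2: "\<rho> a \<le> \<rho> (y \<sqinter> ?j)" using c j by (intro rho_mono) auto
  have zj: "z \<squnion> (y \<squnion> ?j) \<in> carrier L" "z \<sqsubseteq> z \<squnion> (y \<squnion> ?j)" "y \<squnion> ?j \<sqsubseteq> z \<squnion> (y \<squnion> ?j)"
    using c j join_left join_right by auto
  have "y \<sqsubseteq> z \<squnion> (y \<squnion> ?j)" using le_trans[OF yj(1) zj(3)] c j zj by auto
  then have "y \<squnion> z \<sqsubseteq> z \<squnion> (y \<squnion> ?j)" using c zj by (intro join_le) auto
  then have 3: "\<rho> (y \<squnion> z) \<le> \<rho> (z \<squnion> (y \<squnion> ?j))" using c zj by (intro rho_mono) auto
  show ?thesis
    using rho_submod[OF c(3) j(1)] rho_submod[OF c(4) j(2)] 1 2 3 by linarith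
qed

text \<open>Strict submodularity is applied to \<open>a \<squnion> c\<close> and
  \<open>b \<squnion> c\<close>, whose meet is above \<open>c\<close>. If they are comparable, the
  meet is the smaller one, which is strictly above \<open>c\<close>, so the inequality is strict in
  this case too.\<close>

lemma joins_over_common:
  assumes c: "a \<in> carrier L" "b \<in> carrier L" "c \<in> carrier L" and inc: "\<not> a \<sqsubseteq> c" "\<not> b \<sqsubseteq> c"
  shows "\<rho> ((a \<squnion> c) \<squnion> (b \<squnion> c)) + \<rho> c < \<rho> (a \<squnion> c) + \<rho> (b \<squnion> c)"
proof -
  have j: "a \<squnion> c \<in> carrier L" "b \<squnion> c \<in> carrier L" "(a \<squnion> c) \<sqinter> (b \<squnion> c) \<in> carrier L"
    using c by auto
  have above: "c \<sqsubseteq> a \<squnion> c" "c \<sqsubseteq> b \<squnion> c" using c join_right by auto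
  have ne: "a \<squnion> c \<noteq> c" "b \<squnion> c \<noteq> c" using inc c join_left by metis+
  have m: "c \<sqsubseteq> (a \<squnion> c) \<sqinter> (b \<squnion> c)" using c j above by (intro meet_le) auto
  show ?thesis
  proof (cases "a \<squnion> c \<sqsubseteq> b \<squnion> c \<or> b \<squnion> c \<sqsubseteq> a \<squnion> c")
    case True
    have "\<rho> c < \<rho> ((a \<squnion> c) \<sqinter> (b \<squnion> c))"
      using True
    proof
      assume "a \<squnion> c \<sqsubseteq> b \<squnion> c"
      then show ?thesis
        using rho_strict[OF c(3) j(1)] above ne le_iff_join[OF j(1,2)] by (auto simp: lless_iff)
    next
      assume "b \<squnion> c \<sqsubseteq> a \<squnion> c"
      then show ?thesis
        using rho_strict[OF c(3) j(2)] above ne le_iff_join[OF j(2,1)] meet_comm[of L "a \<squnion> c"]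
        by (auto simp: lless_iff)
    qed
    then show ?thesis using comparable_modular[OF j(1,2) True] by linarith
  next
    case False
    then show ?thesis
      using rho_strict_submod[OF j(1,2)] rho_mono[OF c(3) j(3) m] by auto
  qed
qed

text \<open>An element of least rank strictly above \<open>x\<close> and below or equal to
  \<open>y\<close> covers \<open>x\<close>.\<close>

lemma ex_cover_below:
  assumes x: "x \<in> carrier L" and y: "y \<in> carrier L" and xy: "x \<sqsubset> y"
  obtains a where "covers L a x" "a \<sqsubseteq> y"
proof -
  let ?P = "\<lambda>a. a \<in> carrier L \<and> x \<sqsubset> a \<and> a \<sqsubseteq> y"
  have "?P y" using assms by auto
  then obtain a where a: "?P a" and least: "\<And>z. ?P z \<Longrightarrow> \<rho> a \<le> \<rho> z"
    using ex_has_least_nat[of ?P y \<rho>] by blast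
  have "\<not> (x \<sqsubset> z \<and> z \<sqsubset> a)" if z: "z \<in> carrier L" for z
  proof
    assume *: "x \<sqsubset> z \<and> z \<sqsubset> a"
    then have "z \<sqsubseteq> y" using le_trans[of z a y] a z y by (auto simp: lless_iff)
    then show False using least[of z] rho_strict[of z a] * a z by auto
  qed
  then show thesis using a x that by (auto simp: covers_def)
qed

lemma covers_incomparable: "covers L a x \<Longrightarrow> covers L b x \<Longrightarrow> a \<noteq> b \<Longrightarrow> \<not> a \<sqsubseteq> b"
  by (auto simp: covers_def lless_iff)

lemma covers_meet:
  assumes a: "covers L a x" and b: "covers L b x" and ne: "a \<noteq> b"
  shows "a \<sqinter> b = x"
proof (rule ccontr)
  assume neq: "a \<sqinter> b \<noteq> x"
  have c: "a \<in> carrier L" "b \<in> carrier L" "x \<in> carrier L" "x \<sqsubseteq> a" "x \<sqsubseteq> b"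
    using a b by (auto simp: covers_def lless_iff)
  then have "x \<sqsubseteq> a \<sqinter> b" "a \<sqinter> b \<sqsubseteq> a" "a \<sqinter> b \<sqsubseteq> b" "a \<sqinter> b \<in> carrier L"
    by (auto intro: meet_le meet_left meet_right)
  then show False
    using a neq covers_incomparable[OF a b ne] unfolding covers_def by (metis lless_iff)
qed

end

section \<open>Existence of disjoint blocks, a least element and a strict rank\<close>

lemma ex_disjoint_nat_sets:
  assumes "finite I"
  obtains S :: "'i \<Rightarrow> nat set" and K :: "nat set"
  where "\<And>y. finite (S y)" "\<And>y. card (S y) = N" "finite K" "card K = k"
    "\<And>y w. y \<in> I \<Longrightarrow> w \<in> I \<Longrightarrow> y \<noteq> w \<Longrightarrow> S y \<inter> S w = {}" "\<And>y. S y \<inter> K = {}"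
proof -
  obtain h :: "'i \<Rightarrow> nat" where h: "inj_on h I"
    using finite_imp_inj_to_nat_seg[OF assms] by blast
  \<comment> \<open>The first coordinate separates the blocks; the value 0 is reserved for
    \<open>?K\<close>, hence the \<open>Suc\<close>.\<close>
  let ?S = "\<lambda>y. (\<lambda>i. prod_encode (Suc (h y), i)) ` {..<N}"
  let ?K = "(\<lambda>i. prod_encode (0, i)) ` {..<k}"
  show thesis
  proof (rule that[of ?S ?K])
    show "card (?S y) = N" for y by (subst card_image) (auto simp: inj_on_def)
    show "card ?K = k" by (subst card_image) (auto simp: inj_on_def)
  qed (use h in \<open>auto simp: inj_on_def\<close>)
qed

lemma (in lattice) ex_least:
  assumes "finite (carrier L)" "carrier L \<noteq> {}"
  obtains z where "z \<in> carrier L" "\<And>y. y \<in> carrier L \<Longrightarrow> z \<sqsubseteq> y"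
  using finite_inf_greatest[OF assms(1) subset_refl assms(2)] that
  by (auto simp: greatest_def Lower_def)

lemma (in lattice) ex_strict_rank:
  assumes fin: "finite (carrier L)"
  obtains \<rho> where "strict_rank_lattice L \<rho>"
proof -
  \<comment> \<open>a concave function of the number of elements below: each step gains at least half of what remains\<close>
  define d where "d y = card {z \<in> carrier L. z \<sqsubset> y}" for y
  define m where "m = card (carrier L)"
  define \<rho> :: "'a \<Rightarrow> nat" where "\<rho> y = 2 ^ m - 2 ^ (m - d y)" for y
  have dm: "d y \<le> m" for y unfolding d_def m_def using fin by (intro card_mono) auto
  have d_strict: "d y < d w" if "y \<in> carrier L" "w \<in> carrier L" "y \<sqsubset> w" for y w
    unfolding d_def
  proof (rule psubset_card_mono)
    have "{z \<in> carrier L. z \<sqsubset> y} \<subseteq> {z \<in> carrier L. z \<sqsubset> w}"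
      using that le_trans le_antisym by (auto simp: lless_iff)
    moreover have "y \<in> {z \<in> carrier L. z \<sqsubset> w} - {z \<in> carrier L. z \<sqsubset> y}"
      using that by (auto simp: lless_iff)
    ultimately show "{z \<in> carrier L. z \<sqsubset> y} \<subset> {z \<in> carrier L. z \<sqsubset> w}" by blast
  qed (use fin in simp)
  have half: "2 * 2 ^ (m - d w) \<le> (2::nat) ^ (m - d y)"
    if "y \<in> carrier L" "w \<in> carrier L" "y \<sqsubset> w" for y w
  proof -
    have "Suc (m - d w) \<le> m - d y" using d_strict[OF that] dm[of w] by linarith
    then have "(2::nat) ^ Suc (m - d w) \<le> 2 ^ (m - d y)" by (intro power_increasing) auto
    then show ?thesis by simp
  qed
  have compl: "\<rho> y + 2 ^ (m - d y) = 2 ^ m" for y by (simp add: \<rho>_def power_increasing)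
  have pos: "0 < (2::nat) ^ (m - d y)" for y by simp
  have "strict_rank_lattice L \<rho>"
  proof
    show "\<rho> y < \<rho> w" if "y \<in> carrier L" "w \<in> carrier L" "y \<sqsubset> w" for y w
      using half[OF that] compl[of y] compl[of w] pos[of w] by linarith
    show "\<rho> z = 0" if "z \<in> carrier L" "\<forall>y \<in> carrier L. z \<sqsubseteq> y" for z
    proof -
      have "{y \<in> carrier L. y \<sqsubset> z} = {}" using that le_antisym by (auto simp: lless_iff)
      then have "d z = 0" unfolding d_def by (simp only: card.empty)
      then show ?thesis by (simp add: \<rho>_def)
    qed
    show "\<rho> (y \<squnion> w) + \<rho> (y \<sqinter> w) < \<rho> y + \<rho> w"
      if yw: "y \<in> carrier L" "w \<in> carrier L" and inc: "\<not> y \<sqsubseteq> w" "\<not> w \<sqsubseteq> y" for y w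
    proof -
      have m: "y \<sqinter> w \<in> carrier L" "y \<sqinter> w \<sqsubseteq> y" "y \<sqinter> w \<sqsubseteq> w"
        using yw meet_left meet_right by auto
      then have "y \<sqinter> w \<sqsubset> y" "y \<sqinter> w \<sqsubset> w" using inc by (metis lless_iff)+
      \<comment> \<open>By \<open>half\<close>, the complements \<open>2 ^ m - \<rho>\<close> of
        \<open>y\<close> and \<open>w\<close> add up to at most that of the meet; the positive
        complement of the join makes the inequality strict.\<close>
      then show ?thesis
        using half[OF m(1) yw(1)] half[OF m(1) yw(2)] compl[of y] compl[of w]
          compl[of "y \<squnion> w"] compl[of "y \<sqinter> w"] pos[of "y \<squnion> w"] by linarith
    qed
  qed (rule fin)
  then show thesis by (rule that)
qed

section \<open>The nontransversal matroid for an element with three covers\<close>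

lemma (in strict_rank_lattice) ex_nontransversal:
  assumes x: "x \<in> carrier L" and many: "2 < card {y. covers L y x}"
  obtains E :: "nat set" and \<I>
  where "matroid E \<I>" "order_isomorphic (cyclic_flats E \<I>) L" "\<not> transversal E \<I>"
proof -
  let ?C = "{y. covers L y x}"
  \<comment> \<open>For distinct covers the truncated subtraction loses nothing: they meet in
    \<open>x\<close>, so submodularity makes the difference nonnegative.\<close>
  define s where "s = (\<lambda>(a, b). \<rho> a + \<rho> b - \<rho> x - \<rho> (a \<squnion> b))"
  let ?P = "\<lambda>p. fst p \<in> ?C \<and> snd p \<in> ?C \<and> fst p \<noteq> snd p"
  have "\<not> ?C \<subseteq> {u}" for u
    using many card_mono[of "{u}" ?C] by auto
  then obtain p0 where "?P p0" by (metis fst_conv snd_conv insertI1 subsetI)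
  then obtain p where p: "?P p" and pmin: "\<And>q. ?P q \<Longrightarrow> s p \<le> s q"
    using ex_has_least_nat[of ?P p0 s] by blast
  define a b k where "a = fst p" and "b = snd p" and "k = s p"
  have ca: "covers L a x" and cb: "covers L b x" and ab: "a \<noteq> b"
    using p by (auto simp: a_def b_def)
  have "\<not> ?C \<subseteq> {a, b}"
    using many card_mono[of "{a, b}" ?C] card_insert_le_m1[of 2 "{b}" a] by auto
  then obtain c where cc: "covers L c x" and ac: "a \<noteq> c" and bc: "b \<noteq> c" by auto
  have abc: "a \<in> carrier L" "b \<in> carrier L" "c \<in> carrier L"
    using ca cb cc by (auto simp: covers_def)
  have slack: "\<rho> x + \<rho> (u \<squnion> v) + k \<le> \<rho> u + \<rho> v \<and> (u = a \<and> v = b \<longrightarrow> \<rho> x + \<rho> (u \<squnion> v) + k = \<rho> u + \<rho> v)"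
    if uv: "covers L u x" "covers L v x" "u \<noteq> v" for u v
  proof -
    have "k \<le> \<rho> u + \<rho> v - \<rho> x - \<rho> (u \<squnion> v)" using pmin[of "(u, v)"] uv by (simp add: k_def s_def)
    moreover have "k = \<rho> a + \<rho> b - \<rho> x - \<rho> (a \<squnion> b)"
      by (simp add: k_def s_def a_def b_def split_beta)
    moreover have "\<rho> (u \<squnion> v) + \<rho> x \<le> \<rho> u + \<rho> v"
      using rho_submod[of u v] covers_meet[OF uv] uv by (simp add: covers_def)
    ultimately show ?thesis by auto
  qed
  \<comment> \<open>Choose covers \<open>u\<close>, \<open>v\<close> of \<open>x\<close> below
    \<open>y\<close>, \<open>z\<close>. They differ because \<open>y\<close> and \<open>z\<close>
    meet in \<open>x\<close>, and \<open>slack_mono\<close> carries their slack up.\<close>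
  have slack_above: "\<rho> x + \<rho> (y \<squnion> z) + k \<le> \<rho> y + \<rho> z"
    if yz: "y \<in> carrier L" "z \<in> carrier L" "x \<sqsubset> y" "x \<sqsubset> z" "y \<sqinter> z = x" for y z
  proof -
    obtain u where u: "covers L u x" "u \<sqsubseteq> y" using ex_cover_below[OF x yz(1,3)] .
    obtain v where v: "covers L v x" "v \<sqsubseteq> z" using ex_cover_below[OF x yz(2,4)] .
    have uvc: "u \<in> carrier L" "v \<in> carrier L" using u v by (auto simp: covers_def)
    have "u \<noteq> v"
    proof
      assume "u = v"
      then have "u \<sqsubseteq> x" using meet_le[of u y z] u v yz uvc by auto
      then show False using u x uvc le_antisym by (auto simp: covers_def lless_iff)
    qed
    then show ?thesis
      using slack[OF u(1) v(1)] slack_mono[OF uvc yz(1,2) u(2) v(2)] by linarith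
  qed
  \<comment> \<open>Each \<open>Z y\<close> with \<open>y\<close> above \<open>x\<close> must have
    room for an independent set of size \<open>\<rho> x + k\<close>. A second cover \<open>v\<close>
    supplies this, since \<open>\<rho> v\<close> cancels against
    \<open>\<rho> (u \<squnion> v)\<close>.\<close>
  have gap: "\<rho> x + k \<le> \<rho> y" if y: "y \<in> carrier L" "x \<sqsubset> y" for y
  proof -
    obtain u where u: "covers L u x" "u \<sqsubseteq> y" using ex_cover_below[OF x y] .
    obtain v where v: "covers L v x" "v \<noteq> u" using ca cb ab by metis
    have uv: "u \<in> carrier L" "v \<in> carrier L" using u v by (auto simp: covers_def)
    have "\<rho> v \<le> \<rho> (u \<squnion> v)" using uv join_right by (intro rho_mono) auto
    then show ?thesis using slack[OF u(1) v(1)] v(2) rho_mono[OF uv(1) y(1) u(2)] by auto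
  qed
  obtain bot where bot: "bot \<in> carrier L" "\<And>y. y \<in> carrier L \<Longrightarrow> bot \<sqsubseteq> y"
    using ex_least[OF finite_L] x by blast
  \<comment> \<open>The sum bounds every single \<open>\<rho> y\<close>, so one block size satisfies
    \<open>core_large\<close> for all \<open>y\<close>.\<close>
  define N where "N = 2 * sum \<rho> (carrier L) + 1"
  obtain S :: "'l \<Rightarrow> nat set" and K where S: "\<And>y. finite (S y)" "\<And>y. card (S y) = N"
    and K: "finite K" "card K = k"
    and SS: "\<And>y w. y \<in> carrier L \<Longrightarrow> w \<in> carrier L \<Longrightarrow> y \<noteq> w \<Longrightarrow> S y \<inter> S w = {}"
    and SK: "\<And>y. S y \<inter> K = {}"
    by (rule ex_disjoint_nat_sets[OF finite_L, of N k]) blast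
  define Z where "Z y = (\<Union>w \<in> {w \<in> carrier L. w \<sqsubseteq> y}. S w) \<union> (if x \<sqsubset> y then K else {})" for y
  define E where "E = (\<Union>w \<in> carrier L. S w) \<union> K"
  \<comment> \<open>A block \<open>S u\<close> inside both \<open>Z y\<close> and \<open>Z w\<close>
    has \<open>u\<close> below \<open>y \<sqinter> w\<close>, so only elements of \<open>K\<close>
    can be lost at the meet.\<close>
  have excess: "Z y \<inter> Z w - Z (y \<sqinter> w) \<subseteq> (if x \<sqsubset> y \<and> x \<sqsubset> w \<and> \<not> x \<sqsubset> y \<sqinter> w then K else {})"
    if yw: "y \<in> carrier L" "w \<in> carrier L" for y w
  proof
    fix e assume e: "e \<in> Z y \<inter> Z w - Z (y \<sqinter> w)"
    have "e \<notin> S u" if u: "u \<in> carrier L" for u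
    proof
      assume eu: "e \<in> S u"
      then have "u \<sqsubseteq> y" "u \<sqsubseteq> w"
        using e u SS SK by (auto simp: Z_def split: if_splits) blast+
      then have "u \<sqsubseteq> y \<sqinter> w" using u yw by (intro meet_le) auto
      then show False using e eu u by (auto simp: Z_def)
    qed
    then show "e \<in> (if x \<sqsubset> y \<and> x \<sqsubset> w \<and> \<not> x \<sqsubset> y \<sqinter> w then K else {})"
      using e by (auto simp: Z_def split: if_splits)
  qed
  interpret M: cored_lattice L E Z S \<rho> bot
  proof
    show "finite (carrier L)" by (rule finite_L)
    show "finite E" using finite_L S K by (auto simp: E_def)
    show "bot \<in> carrier L" "\<And>y. y \<in> carrier L \<Longrightarrow> bot \<sqsubseteq> y" "\<rho> bot = 0"
      using bot rho_least by auto
    fix y assume y: "y \<in> carrier L"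
    show "Z y \<subseteq> E" by (auto simp: Z_def E_def)
    show "S y \<subseteq> Z y" using y by (auto simp: Z_def)
    show "2 * \<rho> y < card (S y)"
      using y finite_L member_le_sum[of y "carrier L" \<rho>] by (simp add: S N_def)
    fix w assume w: "w \<in> carrier L"
    show "Z y \<subseteq> Z w" if "y \<sqsubseteq> w"
    proof -
      have "x \<sqsubset> w" if "x \<sqsubset> y"
        using that \<open>y \<sqsubseteq> w\<close> le_trans[of x y w] le_antisym[of x y] x y w by (auto simp: lless_iff)
      moreover have "u \<sqsubseteq> w" if "u \<in> carrier L" "u \<sqsubseteq> y" for u
        using le_trans[OF that(2) \<open>y \<sqsubseteq> w\<close>] that y w by auto
      ultimately show ?thesis by (auto simp: Z_def)
    qed
    show "S y \<inter> Z w = {}" if "\<not> y \<sqsubseteq> w"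
      using that SS[OF y] SK[of y] by (fastforce simp: Z_def split: if_splits)
    show "\<rho> y < \<rho> w" if "y \<sqsubset> w" using rho_strict[OF y w that] .
    show "\<rho> (y \<squnion> w) + \<rho> (y \<sqinter> w) + card (Z y \<inter> Z w - Z (y \<sqinter> w)) \<le> \<rho> y + \<rho> w"
    proof (cases "x \<sqsubset> y \<and> x \<sqsubset> w \<and> \<not> x \<sqsubset> y \<sqinter> w")
      case True
      then have "x \<sqsubseteq> y \<sqinter> w" using x y w by (auto simp: lless_iff intro: meet_le)
      then have "y \<sqinter> w = x" using True by (auto simp: lless_iff)
      then have "\<rho> x + \<rho> (y \<squnion> w) + k \<le> \<rho> y + \<rho> w" using slack_above y w True by auto
      moreover have "card (Z y \<inter> Z w - Z (y \<sqinter> w)) \<le> k"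
        using excess[OF y w] True K card_mono by auto
      ultimately show ?thesis using \<open>y \<sqinter> w = x\<close> by simp
    next
      case False
      then have "Z y \<inter> Z w - Z (y \<sqinter> w) = {}" using excess[OF y w] by (auto split: if_splits)
      then have "card (Z y \<inter> Z w - Z (y \<sqinter> w)) = 0" by (simp only: card.empty)
      then show ?thesis using rho_submod[OF y w] by linarith
    qed
  qed
  obtain B where B: "B \<subseteq> S x - {}" "card B = \<rho> x" "B \<in> M.indep" "finite B"
    by (rule M.ex_core_basis[OF x, of "{}"]) auto
  \<comment> \<open>This independent set lies in \<open>Z y\<close> for every \<open>y\<close>
    strictly above \<open>x\<close>, though \<open>Z x\<close> itself has rank only
    \<open>\<rho> x\<close>.\<close>
  let ?T = "B \<union> K"
  have cardT: "card ?T = \<rho> x + k" using B K SK[of x] by (subst card_Un_disjoint) auto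
  have TZ: "?T \<subseteq> Z y" if "y \<in> carrier L" "x \<sqsubset> y" for y
    using that B x by (auto simp: Z_def lless_iff)
  have T: "?T \<in> M.indep"
  proof -
    have "card (?T \<inter> Z w) \<le> \<rho> w" if w: "w \<in> carrier L" for w
    proof (cases "x \<sqsubset> w")
      case True
      then show ?thesis using TZ[OF w] gap[OF w] cardT by (simp add: inf_absorb1)
    next
      case False
      then have "?T \<inter> Z w = B \<inter> Z w" using SK by (auto simp: Z_def)
      then show ?thesis using M.indepD[OF B(3) w] by simp
    qed
    moreover have "?T \<subseteq> E" using B x by (auto simp: E_def)
    ultimately show ?thesis by (simp add: M.indep_def)
  qed
  let ?t = "(a \<squnion> c) \<squnion> (b \<squnion> c)"
  have j: "a \<squnion> c \<in> carrier L" "b \<squnion> c \<in> carrier L" "?t \<in> carrier L" using abc by auto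
  have t: "a \<squnion> c \<sqsubseteq> ?t" "b \<squnion> c \<sqsubseteq> ?t" using j join_left join_right by auto
  note inc = covers_incomparable[OF ca cb ab] covers_incomparable[OF cb ca ab[symmetric]]
    covers_incomparable[OF ca cc ac] covers_incomparable[OF cc ca ac[symmetric]]
    covers_incomparable[OF cb cc bc] covers_incomparable[OF cc cb bc[symmetric]]
  have "\<not> transversal E M.indep"
  proof (rule M.not_transversal[OF abc inc j(3)])
    show "a \<sqsubseteq> ?t" using le_trans[OF join_left[of a c] t(1)] abc j by auto
    show "b \<sqsubseteq> ?t" using le_trans[OF join_left[of b c] t(2)] abc j by auto
    show "c \<sqsubseteq> ?t" using le_trans[OF join_right[of a c] t(1)] abc j by auto
    show "?T \<in> M.indep" by (rule T)
    show "?T \<subseteq> Z a" "?T \<subseteq> Z b" "?T \<subseteq> Z c" using TZ ca cb cc by (auto simp: covers_def)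
    \<comment> \<open>The minimal slack is attained at \<open>a\<close>, \<open>b\<close>, so
      \<open>\<rho> a + \<rho> b = card ?T + \<rho> (a \<squnion> b)\<close>; what remains is
      \<open>joins_over_common\<close>.\<close>
    show "\<rho> a + \<rho> b + \<rho> c + \<rho> ?t < card ?T + \<rho> (a \<squnion> b) + \<rho> (a \<squnion> c) + \<rho> (b \<squnion> c)"
      using joins_over_common[OF abc inc(3,5)] slack[OF ca cb ab] cardT by auto
  qed
  then show thesis using M.matroid_indep M.cyclic_flats_isomorphic that by blast
qed

theorem theorem4p1:
  fixes L :: "('l, 'm) gorder_scheme"
  assumes "Tr_lattice L"
  shows "\<forall>x \<in> carrier L. card {y. covers L y x} \<le> 2"
proof (rule ballI, rule ccontr)
  fix x assume x: "x \<in> carrier L" and "\<not> card {y. covers L y x} \<le> 2"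
  then have many: "2 < card {y. covers L y x}" by simp
  have L: "lattice L" "finite (carrier L)" using assms by (auto simp: Tr_lattice_def)
  obtain \<rho> where "strict_rank_lattice L \<rho>" by (rule lattice.ex_strict_rank[OF L])
  then obtain E :: "nat set" and \<I> where
    "matroid E \<I>" "order_isomorphic (cyclic_flats E \<I>) L" "\<not> transversal E \<I>"
    by (rule strict_rank_lattice.ex_nontransversal[OF _ x many])
  then show False using assms by (auto simp: Tr_lattice_def)
qed

end
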